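(* Let $R$ be a short rate process from the class $\mathbb{A}_g(a,b;\alpha_1,\dots,\alpha_g;\eta_1,\dots,\eta_g)$ such that $\alpha_g\in(1,2)$ and such that $R(0)=r_0>0$ or $b>0$. Then for every $t\in(0,+\infty)$ and every $\varepsilon>0$, $$\mathbb{E}\,R(t)^{\alpha_g+\varepsilon}=+\infty.$$
   Context: Parameters: $g\ge1$, $a\in\mathbb{R}$, $b\ge0$, $2\ge\alpha_1>\alpha_2>\dots>\alpha_g>1$, $\eta_1,\dots,\eta_g>0$, initial value $R(0)=r_0\ge0$. Put $c_2=\frac12$, $c_\alpha=\frac{\Gamma(2-\alpha)}{\alpha(\alpha-1)}$ for $\alpha\in(1,2)$, and $d_i=\eta_i/c_{\alpha_i}$. The class $\mathbb{A}_g(a,b;\alpha_1,\dots,\alpha_g;\eta_1,\dots,\eta_g)$ consists of the nonnegative Markov processes with generator $$\mathcal{A}f(x)=cxf''(x)+(ax+b)f'(x)+x\int_{(0,+\infty)}\{f(x+v)-f(x)-f'(x)v\}\,\mu(dv),\qquad \mu(dv)=\sum_{i=l}^g\frac{d_i}{v^{1+\alpha_i}}dv,\ v>0,$$ where $c=\eta_1$, $l=2$ if $\alpha_1=2$, and $c=0$, $l=1$ otherwise. Equivalently, $R$ has the same generator as the unique strong nonnegative solution of the canonical equation $$dR(t)=(aR(t-)+b)\,dt+\sum_{i=1}^gd_i^{1/\alpha_i}R(t-)^{1/\alpha_i}\,dZ^{\alpha_i}(t),\qquad R(0)=r_0\ge 0,$$ where $Z^{\alpha_1},\dots,Z^{\alpha_g}$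 are independent canonical stable martingales: $Z^2$ is a standard Brownian motion, and for $\alpha\in(1,2)$, $Z^\alpha$ is the real Lévy martingale with no Wiener part and Lévy measure $v^{-\alpha-1}\mathbf{1}_{\{v>0\}}dv$. *)

theory Defs
  imports "HOL-Probability.Probability"
begin

section \<open>Markov processes with values in $[0,\infty)$\<close>

abbreviation nonneg_borel :: "real measure" where
  "nonneg_borel \<equiv> restrict_space borel {0..}"

text \<open>Time-homogeneous, conservative transition functions on $[0,\infty)$:
  \<open>p t x\<close> is the law at time \<open>t\<close> of the process started at \<open>x\<close>.
  Only arguments \<open>t \<ge> 0\<close>, \<open>x \<ge> 0\<close> matter.\<close>

definition transition_function :: "(real \<Rightarrow> real \<Rightarrow> real measure) \<Rightarrow> bool" where
  "transition_function p \<longleftrightarrow>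
     (\<forall>t\<ge>0. p t \<in> measurable nonneg_borel (prob_algebra nonneg_borel)) \<and>
     (\<forall>x\<ge>0. p 0 x = return nonneg_borel x) \<and>
     (\<forall>s\<ge>0. \<forall>t\<ge>0. \<forall>x\<ge>0. p (s + t) x = p s x \<bind> p t)"

definition past :: "'w measure \<Rightarrow> (real \<Rightarrow> 'w \<Rightarrow> real) \<Rightarrow> real \<Rightarrow> 'w measure" where
  "past M R s = sigma (space M) (\<Union>u\<in>{0..s}. {R u -` B \<inter> space M |B. B \<in> sets nonneg_borel})"

definition nonneg_markov_process ::
  "'w measure \<Rightarrow> (real \<Rightarrow> 'w \<Rightarrow> real) \<Rightarrow> (real \<Rightarrow> real \<Rightarrow> real measure) \<Rightarrow> bool" where
  "nonneg_markov_process M R p \<longleftrightarrow>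
     prob_space M \<and> transition_function p \<and>
     (\<forall>t\<ge>0. R t \<in> measurable M nonneg_borel) \<and>
     (\<forall>s\<ge>0. \<forall>t\<ge>0. \<forall>B\<in>sets nonneg_borel.
        AE w in M. real_cond_exp M (past M R s) (\<lambda>w. indicator B (R (s + t) w)) w
                     = measure (p t (R s w)) B)"

text \<open>One-sided at the boundary point \<open>0\<close>.\<close>

abbreviation deriv_nonneg :: "(real \<Rightarrow> real) \<Rightarrow> real \<Rightarrow> real" where
  "deriv_nonneg f x \<equiv> vector_derivative f (at x within {0..})"

definition C2c_nonneg :: "(real \<Rightarrow> real) set" where
  "C2c_nonneg = {f. f differentiable_on {0..} \<and> deriv_nonneg f differentiable_on {0..} \<and>
     continuous_on {0..} (deriv_nonneg (deriv_nonneg f)) \<and> (\<exists>K. \<forall>x\<ge>K. f x = 0)}"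

text \<open>The usual domain for generators of affine (CBI) processes: $C_c^2([0,\infty))$ together with
  the functions $x \mapsto e^{-\lambda x}$, $\lambda > 0$. Passing to linear
  combinations of these adds nothing, both sides of the generator equation being linear.\<close>

definition test_functions :: "(real \<Rightarrow> real) set" where
  "test_functions = C2c_nonneg \<union> {(\<lambda>x. exp (- l * x)) |l. l > 0}"

text \<open>The generator of the semigroup $P_t f(x) = \int f(y)\,p_t(x,dy)$ is the derivative at
  $t = 0$ in the supremum norm on $[0,\infty)$.\<close>

definition has_generator ::
  "(real \<Rightarrow> real \<Rightarrow> real measure) \<Rightarrow> ((real \<Rightarrow> real) \<Rightarrow> real \<Rightarrow> real) \<Rightarrow> bool" where
  "has_generator p A \<longleftrightarrow>
     (\<forall>f\<in>test_functions.
        uniform_limit {0..} (\<lambda>t x. ((\<integral>y. f y \<partial>p t x) - f x) / t) (A f) (at_right 0))"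


section \<open>The class of short rates\<close>

definition c_stable :: "real \<Rightarrow> real" where
  "c_stable \<alpha> = (if \<alpha> = 2 then 1 / 2 else Gamma (2 - \<alpha>) / (\<alpha> * (\<alpha> - 1)))"

text \<open>The families \<open>\<alpha>\<close>, \<open>\<eta>\<close> are indexed by $1,\dots,g$.\<close>

definition jump_coeff :: "(nat \<Rightarrow> real) \<Rightarrow> (nat \<Rightarrow> real) \<Rightarrow> nat \<Rightarrow> real" where
  "jump_coeff \<alpha> \<eta> i = \<eta> i / c_stable (\<alpha> i)"

definition diffusion_coeff :: "(nat \<Rightarrow> real) \<Rightarrow> (nat \<Rightarrow> real) \<Rightarrow> real" where
  "diffusion_coeff \<alpha> \<eta> = (if \<alpha> 1 = 2 then \<eta> 1 else 0)"

definition first_jump_index :: "(nat \<Rightarrow> real) \<Rightarrow> nat" where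
  "first_jump_index \<alpha> = (if \<alpha> 1 = 2 then 2 else 1)"

definition jump_measure :: "nat \<Rightarrow> (nat \<Rightarrow> real) \<Rightarrow> (nat \<Rightarrow> real) \<Rightarrow> real measure" where
  "jump_measure g \<alpha> \<eta> = density lborel (\<lambda>v. ennreal (indicator {0<..} v *
     (\<Sum>i = first_jump_index \<alpha>..g. jump_coeff \<alpha> \<eta> i / v powr (1 + \<alpha> i))))"

text \<open>The integral is restricted to \<open>v > 0\<close>, although the measure lives there, so that values of
  \<open>f\<close> on the negative half-line cannot affect measurability.\<close>

definition short_rate_generator ::
  "nat \<Rightarrow> real \<Rightarrow> real \<Rightarrow> (nat \<Rightarrow> real) \<Rightarrow> (nat \<Rightarrow> real) \<Rightarrow> (real \<Rightarrow> real) \<Rightarrow> real \<Rightarrow> real" where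
  "short_rate_generator g a b \<alpha> \<eta> f x =
     diffusion_coeff \<alpha> \<eta> * x * deriv_nonneg (deriv_nonneg f) x
     + (a * x + b) * deriv_nonneg f x
     + x * (LINT v:{0<..}|jump_measure g \<alpha> \<eta>. f (x + v) - f x - deriv_nonneg f x * v)"

definition short_rate_class ::
  "'w measure \<Rightarrow> nat \<Rightarrow> real \<Rightarrow> real \<Rightarrow> (nat \<Rightarrow> real) \<Rightarrow> (nat \<Rightarrow> real) \<Rightarrow> (real \<Rightarrow> 'w \<Rightarrow> real) set" where
  "short_rate_class M g a b \<alpha> \<eta> =
     {R. \<exists>p. nonneg_markov_process M R p \<and> has_generator p (short_rate_generator g a b \<alpha> \<eta>)}"

end

theory Submission
  imports Defs
begin

text \<open>For $\lambda > 0$ put $k_\lambda(y) = (1 - e^{-\lambda y})^2 = e^{-2\lambda y} - 2 e^{-\lambda y} + 1$.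
  On exponentials the generator is
  $e^{-\lambda y}\,(y\,\psi(\lambda) - b\lambda)$ with
  $\psi(\lambda) = \sum_i \gamma_i \lambda^{\alpha_i} - a\lambda$, $\gamma_i > 0$, and as $2^{\alpha_g} > 2$ this
  gives, uniformly in $0 < \lambda \le 1$, the inequality
  $\mathcal{A} k_\lambda \ge \kappa\lambda^{\alpha_g}\, y e^{-2y} - C k_\lambda$ with $\kappa > 0$.
  A Gronwall argument for $s \mapsto \mathbb{E}\, k_\lambda(R(s))$ then yields
  $\mathbb{E}\, k_\lambda(R(t)) \ge c\lambda^{\alpha_g}$ with $c > 0$, because $R$ spends some time away from $0$.
  On the other hand $k_\lambda(y) \le (\lambda y)^r$ for $r \le 2$, so a finite moment of order
  $\alpha_g + \varepsilon$ would force $\mathbb{E}\, k_\lambda(R(t)) = O(\lambda^r)$ with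
  $r = \min(\alpha_g + \varepsilon, 2) > \alpha_g$, a contradiction as $\lambda \to 0$.\<close>

section \<open>Elementary bound for the second difference of exponentials\<close>

lemma x_exp_minus_le: "x * exp (- x) \<le> 1 - exp (- (x::real))"
proof -
  have "(1 + x) * exp (- x) \<le> exp x * exp (- x)"
    by (intro mult_right_mono exp_ge_add_one_self) simp
  then show ?thesis by (simp add: algebra_simps flip: exp_add)
qed

text \<open>With \<open>e = exp (- l * y)\<close> the bracket is
  \<open>(2 powr \<alpha> - 2) * l powr \<alpha> * e\<^sup>2\<close> minus
  \<open>2 * l powr \<alpha> * e * (1 - e)\<close>. As \<open>l \<le> 1\<close>,
  \<open>e\<^sup>2\<close> dominates \<open>exp (- 2 * y)\<close>; the error is absorbed by the
  square because \<open>l * y * e \<le> 1 - e\<close> and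
  \<open>l powr (\<alpha> - 1) \<le> 1\<close>.\<close>

lemma exp_second_diff_lower:
  fixes l y \<alpha> :: real
  assumes l: "0 < l" "l \<le> 1" and y: "0 \<le> y" and \<alpha>: "1 < \<alpha>"
  shows "y * ((2 * l) powr \<alpha> * exp (- (2 * l) * y) - 2 * l powr \<alpha> * exp (- l * y))
           \<ge> (2 powr \<alpha> - 2) * l powr \<alpha> * (y * exp (- 2 * y)) - 2 * (1 - exp (- l * y))\<^sup>2"
proof -
  define e where "e = exp (- l * y)"
  have e: "0 < e" "e \<le> 1" using l y by (auto simp: e_def)
  have e2: "exp (- (2 * l) * y) = e\<^sup>2"
    by (simp add: e_def power2_eq_square algebra_simps flip: exp_add)
  have ze: "l * y * e \<le> 1 - e" using x_exp_minus_le[of "l * y"] by (simp add: e_def)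
  have "exp (- 2 * y) \<le> e\<^sup>2" using l y unfolding e2[symmetric] by (simp add: mult_left_le_one_le)
  moreover have "2 powr 1 \<le> (2::real) powr \<alpha>" using \<alpha> by (intro powr_mono) auto
  ultimately have A: "(2 powr \<alpha> - 2) * l powr \<alpha> * (y * exp (- 2 * y)) \<le> (2 powr \<alpha> - 2) * l powr \<alpha> * (y * e\<^sup>2)"
    using y by (intro mult_left_mono) auto
  have "l powr \<alpha> * (y * (e * (1 - e))) = l powr (\<alpha> - 1) * ((l * y * e) * (1 - e))"
    using l by (simp add: powr_diff field_simps)
  also have "\<dots> \<le> 1 * ((1 - e) * (1 - e))"
    using l y e ze \<alpha> by (intro mult_mono mult_right_mono powr_le1) auto
  finally have B: "l powr \<alpha> * (y * (e * (1 - e))) \<le> (1 - e)\<^sup>2" by (simp add: power2_eq_square)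
  have "y * ((2 * l) powr \<alpha> * e\<^sup>2 - 2 * l powr \<alpha> * e)
      = (2 powr \<alpha> - 2) * l powr \<alpha> * (y * e\<^sup>2) - 2 * (l powr \<alpha> * (y * (e * (1 - e))))"
    using l by (simp add: powr_mult algebra_simps power2_eq_square)
  then show ?thesis using A B unfolding e2 e_def[symmetric] by linarith
qed

section \<open>The generator on exponentials\<close>

lemma exp_remainder_nonneg: "0 \<le> exp (- x) - 1 + (x::real)"
  using exp_ge_add_one_self[of "-x"] by linarith

lemma exp_remainder_le_square:
  assumes "0 \<le> (x::real)" shows "exp (- x) - 1 + x \<le> x\<^sup>2"
proof -
  have "1 + x \<le> exp x" by (rule exp_ge_add_one_self)
  then have "exp (-x) \<le> 1 / (1 + x)" using assms by (simp add: exp_minus field_simps)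
  also have "\<dots> \<le> 1 - x + x\<^sup>2" using assms by (simp add: field_simps power2_eq_square)
  finally show ?thesis by simp
qed

text \<open>The integrand in the Laplace exponent of a stable process with positive jumps only,
  extended by 0 so that substitutions can be made on the whole line.\<close>

definition stable_kernel :: "real \<Rightarrow> real \<Rightarrow> real \<Rightarrow> real" where
  "stable_kernel \<alpha> l v = indicator {0<..} v * ((exp (- l * v) - 1 + l * v) / v powr (1 + \<alpha>))"

lemma stable_kernel_nonneg: "0 \<le> stable_kernel \<alpha> l v"
  using exp_remainder_nonneg[of "l * v"] by (simp add: stable_kernel_def)

lemma borel_measurable_stable_kernel [measurable]: "stable_kernel \<alpha> l \<in> borel_measurable borel"
  unfolding stable_kernel_def by measurable

text \<open>The summand 0 gives the argument the form of the affine substitution rule for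
  \<open>lborel\<close>. With the Jacobian \<open>l\<close>, the factor accounts for the power
  \<open>l powr \<alpha>\<close> of the integral.\<close>

lemma stable_kernel_scale:
  assumes "l > 0"
  shows "stable_kernel \<alpha> 1 (0 + l * v) = l powr (- 1 - \<alpha>) * stable_kernel \<alpha> l v"
  using assms
  by (auto simp: stable_kernel_def indicator_def powr_mult powr_minus_divide powr_diff
      zero_less_mult_iff field_simps powr_add)

lemma set_integrable_powr_from_0:
  fixes a c :: real assumes "a > -1" "c \<ge> 0"
  shows "set_integrable lborel {0..c} (\<lambda>v. v powr a)"
proof -
  have "set_integrable lebesgue {0..c} (\<lambda>v. v powr a)"
    by (rule nonnegative_absolutely_integrable_1) (use assms in \<open>auto intro: integrable_on_powr_from_0\<close>)
  then show ?thesis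
    unfolding set_integrable_def by (subst (asm) integrable_completion) (auto simp del: scaleR_conv_of_real real_scaleR_def)
qed

lemma set_integrable_powr_to_inf:
  fixes a c :: real assumes "a < -1" "c > 0"
  shows "set_integrable lborel {c..} (\<lambda>v. v powr a)"
proof -
  have "set_integrable lebesgue {c..} (\<lambda>v. v powr a)"
    by (rule nonnegative_absolutely_integrable_1)
      (use has_integral_powr_to_inf[OF assms] in \<open>auto simp: integrable_on_def\<close>)
  then show ?thesis
    unfolding set_integrable_def by (subst (asm) integrable_completion) (auto simp del: scaleR_conv_of_real real_scaleR_def)
qed

text \<open>The compensated numerator is at most \<open>v\<^sup>2\<close> and at most
  \<open>v\<close>. The first bound leaves \<open>v powr (1 - \<alpha>)\<close> near 0, integrable
  as \<alpha> < 2; the second leaves \<open>v powr (- \<alpha>)\<close> at infinity, integrable as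
  \<alpha> > 1.\<close>

lemma integrable_stable_kernel_1:
  assumes "1 < \<alpha>" "\<alpha> < 2"
  shows "integrable lborel (stable_kernel \<alpha> 1)"
proof (rule Bochner_Integration.integrable_bound)
  show "integrable lborel (\<lambda>v. indicator {0..1} v *\<^sub>R v powr (1 - \<alpha>) + indicator {1..} v *\<^sub>R v powr (- \<alpha>))"
    using set_integrable_powr_from_0[of "1 - \<alpha>" 1] set_integrable_powr_to_inf[of "- \<alpha>" 1] assms
    unfolding set_integrable_def by (intro Bochner_Integration.integrable_add) auto
  have "\<bar>stable_kernel \<alpha> 1 v\<bar> \<le> indicator {0..1} v * v powr (1 - \<alpha>) + indicator {1..} v * v powr (- \<alpha>)" for v :: real
  proof (cases "v > 0")
    case True
    have nn: "\<bar>stable_kernel \<alpha> 1 v\<bar> = stable_kernel \<alpha> 1 v"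
      by (rule abs_of_nonneg[OF stable_kernel_nonneg])
    have s: "v / v powr (1 + \<alpha>) = v powr (- \<alpha>)" "v\<^sup>2 / v powr (1 + \<alpha>) = v powr (1 - \<alpha>)"
      using True by (simp_all add: powr_add powr_diff powr_minus field_simps power2_eq_square)
    show ?thesis
    proof (cases "v \<le> 1")
      case c: True
      have "stable_kernel \<alpha> 1 v \<le> v\<^sup>2 / v powr (1 + \<alpha>)"
        using exp_remainder_le_square[of v] True by (simp add: stable_kernel_def divide_right_mono)
      then show ?thesis using nn c True unfolding s by (auto simp: indicator_def)
    next
      case c: False
      have "stable_kernel \<alpha> 1 v \<le> v / v powr (1 + \<alpha>)"
        using True by (simp add: stable_kernel_def divide_right_mono)
      then show ?thesis using nn c True unfolding s by (auto simp: indicator_def)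
    qed
  qed (auto simp: stable_kernel_def indicator_def)
  then show "AE v in lborel. norm (stable_kernel \<alpha> 1 v) \<le> norm (indicator {0..1} v *\<^sub>R v powr (1 - \<alpha>) + indicator {1..} v *\<^sub>R v powr (- \<alpha>))"
    by (intro AE_I2) (simp add: order_trans[OF _ abs_ge_self])
qed auto

lemma integrable_stable_kernel:
  assumes "1 < \<alpha>" "\<alpha> < 2" "l > 0"
  shows "integrable lborel (stable_kernel \<alpha> l)"
  using lborel_integrable_real_affine[OF integrable_stable_kernel_1[OF assms(1,2)], of l 0] assms(3)
  unfolding stable_kernel_scale[OF assms(3)] by simp

lemma integral_stable_kernel:
  assumes "l > 0"
  shows "(\<integral>v. stable_kernel \<alpha> l v \<partial>lborel) = l powr \<alpha> * (\<integral>v. stable_kernel \<alpha> 1 v \<partial>lborel)"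
  using lborel_integral_real_affine[of l "stable_kernel \<alpha> 1" 0] assms
  unfolding stable_kernel_scale[OF assms]
  by (simp add: powr_diff powr_minus field_simps)

text \<open>A nonnegative integrable function with integral 0 vanishes almost everywhere, but the
  kernel is strictly positive on the unit interval, which is not a null set.\<close>

lemma integral_stable_kernel_pos:
  assumes "1 < \<alpha>" "\<alpha> < 2"
  shows "0 < (\<integral>v. stable_kernel \<alpha> 1 v \<partial>lborel)"
proof -
  have pos: "0 < stable_kernel \<alpha> 1 v" if "v > 0" for v
  proof -
    have "1 - v < exp (- v)" using that by (intro exp_minus_greater[THEN iffD2]) simp
    then show ?thesis using that by (simp add: stable_kernel_def)
  qed
  have "(\<integral>v. stable_kernel \<alpha> 1 v \<partial>lborel) \<noteq> 0"
  proof
    assume "(\<integral>v. stable_kernel \<alpha> 1 v \<partial>lborel) = 0"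
    then have "AE v in lborel. stable_kernel \<alpha> 1 v = 0"
      by (subst (asm) integral_nonneg_eq_0_iff_AE)
        (auto intro!: integrable_stable_kernel_1 assms stable_kernel_nonneg)
    then have "AE v in lborel. v \<notin> {0<..<1::real}" by eventually_elim (use pos in force)
    then have "emeasure lborel {v::real. \<not> v \<notin> {0<..<1}} = 0"
      by (subst (asm) AE_iff_measurable[OF _ refl]) auto
    moreover have "{v::real. \<not> v \<notin> {0<..<1}} = {0<..<1}" by auto
    ultimately show False by simp
  qed
  moreover have "0 \<le> (\<integral>v. stable_kernel \<alpha> 1 v \<partial>lborel)" by (intro integral_nonneg_AE AE_I2 stable_kernel_nonneg)
  ultimately show ?thesis by linarith
qed

section \<open>One-sided derivatives and the jump integral of exponentials\<close>

lemma at_within_nonneg_not_bot: "0 \<le> (x::real) \<Longrightarrow> at x within {0..} \<noteq> bot"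
proof (subst trivial_limit_within, rule notI)
  assume "0 \<le> x" "\<not> x islimpt {0..}"
  moreover have "x islimpt {x<..<x+1}" by (simp add: islimpt_greaterThanLessThan1)
  then have "x islimpt {0..}" by (rule islimpt_subset) (use \<open>0 \<le> x\<close> in auto)
  ultimately show False by simp
qed

text \<open>The filter within \<open>{0..}\<close> is nontrivial even at 0, so the derivative chosen
  by \<open>vector_derivative\<close> is the unique one.\<close>

lemma deriv_nonneg_exp:
  assumes "0 \<le> x"
  shows "deriv_nonneg (\<lambda>x. exp (- l * x)) x = - l * exp (- l * x)"
  by (rule vector_derivative_within[OF at_within_nonneg_not_bot[OF assms]])
    (auto intro!: derivative_eq_intros simp: has_real_derivative_iff_has_vector_derivative[symmetric])

lemma deriv_nonneg2_exp:
  assumes "0 \<le> x"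
  shows "deriv_nonneg (deriv_nonneg (\<lambda>x. exp (- l * x))) x = l\<^sup>2 * exp (- l * x)"
proof (rule vector_derivative_within[OF at_within_nonneg_not_bot[OF assms]])
  show "(deriv_nonneg (\<lambda>x. exp (- l * x)) has_vector_derivative l\<^sup>2 * exp (- l * x)) (at x within {0..})"
  proof (rule has_vector_derivative_transform)
    show "((\<lambda>x. - l * exp (- l * x)) has_vector_derivative l\<^sup>2 * exp (- l * x)) (at x within {0..})"
      by (auto intro!: derivative_eq_intros
          simp: has_real_derivative_iff_has_vector_derivative[symmetric] power2_eq_square)
  qed (use assms in \<open>auto intro: deriv_nonneg_exp[simplified]\<close>)
qed

text \<open>The factor \<open>exp (- l * x)\<close> comes out of the compensated increment and
  leaves a sum of stable kernels; scaling turns each of their integrals into a multiple of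
  \<open>l powr \<alpha> i\<close>.\<close>

lemma exp_integral_jump_measure:
  assumes J: "\<And>i. i \<in> {first_jump_index \<alpha>..g} \<Longrightarrow> 1 < \<alpha> i \<and> \<alpha> i < 2 \<and> 0 \<le> jump_coeff \<alpha> \<eta> i"
    and x: "0 \<le> x" and l: "0 < l"
  shows "(LINT v:{0<..}|jump_measure g \<alpha> \<eta>. exp (- l * (x + v)) - exp (- l * x) - (- l * exp (- l * x)) * v)
    = exp (- l * x) * (\<Sum>i = first_jump_index \<alpha>..g.
        jump_coeff \<alpha> \<eta> i * (\<integral>v. stable_kernel (\<alpha> i) 1 v \<partial>lborel) * l powr \<alpha> i)"
proof -
  let ?I = "{first_jump_index \<alpha>..g}"
  \<comment> \<open>The density passes through \<open>ennreal\<close>, which sends negative values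
    to 0; nonnegativity ensures that the real sum survives unchanged.\<close>
  have nn: "0 \<le> (\<Sum>i\<in>?I. jump_coeff \<alpha> \<eta> i / v powr (1 + \<alpha> i))" for v
    using J by (intro sum_nonneg divide_nonneg_nonneg) auto
  have "(LINT v:{0<..}|jump_measure g \<alpha> \<eta>. exp (- l * (x + v)) - exp (- l * x) - (- l * exp (- l * x)) * v)
    = (\<integral>v. (indicator {0<..} v * (\<Sum>i\<in>?I. jump_coeff \<alpha> \<eta> i / v powr (1 + \<alpha> i))) *\<^sub>R
        (indicator {0<..} v *\<^sub>R (exp (- l * (x + v)) - exp (- l * x) + l * exp (- l * x) * v)) \<partial>lborel)"
    unfolding set_lebesgue_integral_def jump_measure_def
    by (subst integral_density) (auto intro!: AE_I2 mult_nonneg_nonneg nn)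
  also have "\<dots> = (\<integral>v. exp (- l * x) * (\<Sum>i\<in>?I. jump_coeff \<alpha> \<eta> i * stable_kernel (\<alpha> i) l v) \<partial>lborel)"
  proof (rule Bochner_Integration.integral_cong[OF refl])
    fix v :: real
    have "exp (- l * (x + v)) - exp (- l * x) + l * exp (- l * x) * v = exp (- l * x) * (exp (- l * v) - 1 + l * v)"
      by (simp add: algebra_simps flip: exp_add)
    then show "(indicator {0<..} v * (\<Sum>i\<in>?I. jump_coeff \<alpha> \<eta> i / v powr (1 + \<alpha> i))) *\<^sub>R
        (indicator {0<..} v *\<^sub>R (exp (- l * (x + v)) - exp (- l * x) + l * exp (- l * x) * v))
      = exp (- l * x) * (\<Sum>i\<in>?I. jump_coeff \<alpha> \<eta> i * stable_kernel (\<alpha> i) l v)"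
      by (simp add: stable_kernel_def indicator_def sum_distrib_left sum_distrib_right mult_ac)
  qed
  also have "\<dots> = exp (- l * x) * (\<Sum>i\<in>?I. jump_coeff \<alpha> \<eta> i * (\<integral>v. stable_kernel (\<alpha> i) l v \<partial>lborel))"
  proof -
    have "integrable lborel (\<lambda>v. jump_coeff \<alpha> \<eta> i * stable_kernel (\<alpha> i) l v)" if "i \<in> ?I" for i
      using J[OF that] l by (intro integrable_mult_right integrable_stable_kernel) auto
    then show ?thesis
      by (subst integral_mult_right_zero, subst Bochner_Integration.integral_sum) simp_all
  qed
  also have "\<dots> = exp (- l * x) * (\<Sum>i\<in>?I.
        jump_coeff \<alpha> \<eta> i * (\<integral>v. stable_kernel (\<alpha> i) 1 v \<partial>lborel) * l powr \<alpha> i)"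
    unfolding integral_stable_kernel[OF l] by (simp only: mult_ac)
  finally show ?thesis .
qed

text \<open>The normalisation by \<open>c_stable\<close> makes \<open>\<gamma> = \<eta>\<close>, but only positivity matters below, and
  that follows from scaling without evaluating the integral over the jumps.\<close>

lemma short_rate_generator_exp:
  assumes g: "g \<ge> 1" and \<alpha>1: "\<alpha> 1 \<le> 2" and dec: "strict_antimono_on {1..g} \<alpha>"
    and \<alpha>g: "\<alpha> g \<in> {1<..<2}" and \<eta>: "\<forall>i\<in>{1..g}. \<eta> i > 0"
  obtains \<gamma> where "\<And>i. i \<in> {1..g} \<Longrightarrow> \<gamma> i > 0"
    and "\<And>l x. \<lbrakk>0 < l; 0 \<le> x\<rbrakk> \<Longrightarrow> short_rate_generator g a b \<alpha> \<eta> (\<lambda>x. exp (- l * x)) x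
          = exp (- l * x) * (x * ((\<Sum>i=1..g. \<gamma> i * l powr \<alpha> i) - a * l) - b * l)"
proof
  define J where "J i = (\<integral>v. stable_kernel (\<alpha> i) 1 v \<partial>lborel)" for i
  \<comment> \<open>At exponent 2 the second derivative contributes
    \<open>\<eta> i * l\<^sup>2\<close>; at any other exponent the jumps contribute the kernel
    integral at scale 1 times the jump coefficient.\<close>
  define \<gamma> where "\<gamma> i = (if \<alpha> i = 2 then \<eta> i else jump_coeff \<alpha> \<eta> i * J i)" for i
  have less: "\<alpha> j < \<alpha> i" if "i \<in> {1..g}" "j \<in> {1..g}" "i < j" for i j
    using monotone_onD[OF dec that] .
  \<comment> \<open>Strict decrease from \<open>\<alpha> 1 \<le> 2\<close> down to
    \<open>\<alpha> g > 1\<close> confines all exponents and lets the value 2 occur at index 1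
    only.\<close>
  have range: "1 < \<alpha> i" "\<alpha> i \<le> 2" "\<alpha> i = 2 \<Longrightarrow> i = 1" if "i \<in> {1..g}" for i
  proof -
    show "1 < \<alpha> i" using less[of i g] that \<alpha>g by (cases "i = g") auto
    have *: "i = 1 \<or> \<alpha> i < \<alpha> 1" using less[of 1 i] that by (cases "i = 1") auto
    show "\<alpha> i \<le> 2" "\<alpha> i = 2 \<Longrightarrow> i = 1" using * \<alpha>1 by auto
  qed
  have coeff: "0 < jump_coeff \<alpha> \<eta> i" if "i \<in> {1..g}" "\<alpha> i \<noteq> 2" for i
  proof -
    have "0 < Gamma (2 - \<alpha> i)" using range[OF that(1)] that(2) by (intro Gamma_real_pos) auto
    then show ?thesis using range[OF that(1)] that \<eta> by (auto simp: jump_coeff_def c_stable_def)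
  qed
  show "\<gamma> i > 0" if "i \<in> {1..g}" for i
  proof (cases "\<alpha> i = 2")
    case False
    then have "0 < J i" unfolding J_def using range[OF that] by (intro integral_stable_kernel_pos) auto
    then show ?thesis using False coeff[OF that] by (simp add: \<gamma>_def)
  qed (use \<eta> that in \<open>simp add: \<gamma>_def\<close>)
  have jump: "i \<in> {1..g} \<and> \<alpha> i \<noteq> 2" if "i \<in> {first_jump_index \<alpha>..g}" for i
    using that range(3)[of i] by (auto simp: first_jump_index_def split: if_splits)
  fix l x :: real assume l: "0 < l" and x: "0 \<le> x"
  \<comment> \<open>The diffusion term is the power with exponent 2, so it fits into the same sum:
    for \<open>\<alpha> 1 = 2\<close> it is the summand at index 1 and the jump sum starts at
    2.\<close>
  have sum: "(\<Sum>i=1..g. \<gamma> i * l powr \<alpha> i)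
      = diffusion_coeff \<alpha> \<eta> * l\<^sup>2 + (\<Sum>i=first_jump_index \<alpha>..g. jump_coeff \<alpha> \<eta> i * J i * l powr \<alpha> i)"
  proof (cases "\<alpha> 1 = 2")
    case True
    have "(\<Sum>i=1..g. \<gamma> i * l powr \<alpha> i) = \<gamma> 1 * l powr \<alpha> 1 + (\<Sum>i=2..g. \<gamma> i * l powr \<alpha> i)"
      using g by (simp add: sum.atLeast_Suc_atMost numeral_2_eq_2)
    also have "(\<Sum>i=2..g. \<gamma> i * l powr \<alpha> i) = (\<Sum>i=2..g. jump_coeff \<alpha> \<eta> i * J i * l powr \<alpha> i)"
    proof (rule sum.cong[OF refl])
      fix i assume "i \<in> {2..g}"
      then have "\<alpha> i \<noteq> 2" using jump[of i] True by (simp add: first_jump_index_def)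
      then show "\<gamma> i * l powr \<alpha> i = jump_coeff \<alpha> \<eta> i * J i * l powr \<alpha> i" by (simp add: \<gamma>_def)
    qed
    finally show ?thesis using True l by (simp add: diffusion_coeff_def first_jump_index_def \<gamma>_def powr_numeral)
  next
    case False
    have "\<gamma> i = jump_coeff \<alpha> \<eta> i * J i" if "i \<in> {1..g}" for i
      using jump[of i] that False by (simp add: \<gamma>_def first_jump_index_def)
    then show ?thesis using False by (simp add: diffusion_coeff_def first_jump_index_def)
  qed
  have Jc: "1 < \<alpha> i \<and> \<alpha> i < 2 \<and> 0 \<le> jump_coeff \<alpha> \<eta> i" if "i \<in> {first_jump_index \<alpha>..g}" for i
    using jump[OF that] range[of i] coeff[of i] by auto
  have "short_rate_generator g a b \<alpha> \<eta> (\<lambda>x. exp (- l * x)) x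
     = diffusion_coeff \<alpha> \<eta> * x * (l\<^sup>2 * exp (- l * x)) + (a * x + b) * (- l * exp (- l * x))
       + x * (exp (- l * x) * (\<Sum>i = first_jump_index \<alpha>..g. jump_coeff \<alpha> \<eta> i * J i * l powr \<alpha> i))"
    unfolding short_rate_generator_def deriv_nonneg2_exp[OF x]
    unfolding deriv_nonneg_exp[OF x]
    by (subst exp_integral_jump_measure) (use Jc x l in \<open>auto simp: J_def\<close>)
  then show "short_rate_generator g a b \<alpha> \<eta> (\<lambda>x. exp (- l * x)) x
          = exp (- l * x) * (x * ((\<Sum>i=1..g. \<gamma> i * l powr \<alpha> i) - a * l) - b * l)"
    unfolding sum by (simp add: algebra_simps)
qed

section \<open>Growth of the second difference along the semigroup\<close>

text \<open>Bounds an Euler factor \<open>1 - z\<close> from below by an exponential, at the price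
  of a doubled rate; \<open>z \<le> 1 / 2\<close> is what
  \<open>(1 + 2 * z) * (1 - z) \<ge> 1\<close> requires.\<close>

lemma one_minus_ge_exp:
  assumes "0 \<le> z" "z \<le> 1 / 2" shows "exp (- 2 * z) \<le> 1 - (z::real)"
proof -
  have "1 + 2 * z \<le> exp (2 * z)" by (rule exp_ge_add_one_self)
  then have "exp (- 2 * z) \<le> 1 / (1 + 2 * z)" using assms by (simp add: exp_minus field_simps)
  also have "\<dots> \<le> 1 - z"
    using assms mult_right_mono[of z "1/2" z] by (simp add: field_simps)
  finally show ?thesis .
qed

text \<open>Gronwall's inequality for a difference inequality, by Euler steps: a step of length
  \<open>h\<close> multiplies by \<open>1 - C * h\<close>, adds the source \<open>h * w\<close> and
  loses at most \<open>h * \<epsilon>\<close>. The admissible step length is uniform in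
  \<open>s\<close>, so the interval can be cut into equal steps. The rate is \<open>2 * C\<close>
  because \<open>1 - C * h \<ge> exp (- 2 * C * h)\<close> for small steps.\<close>

lemma euler_lower_bound:
  fixes K :: "real \<Rightarrow> real"
  assumes s: "s1 < s2" and C: "0 \<le> C" and w: "0 \<le> w" and K0: "0 \<le> K s1"
    and step: "\<And>\<epsilon>. \<epsilon> > 0 \<Longrightarrow> \<exists>h0>0. \<forall>s h. s1 \<le> s \<longrightarrow> 0 < h \<longrightarrow> h \<le> h0 \<longrightarrow> s + h \<le> s2 \<longrightarrow>
      (1 - C * h) * K s + h * w - h * \<epsilon> \<le> K (s + h)"
  shows "exp (- 2 * C * (s2 - s1)) * (K s1 + (s2 - s1) * w) \<le> K s2"
proof (rule field_le_epsilon)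
  fix e :: real assume e: "e > 0"
  \<comment> \<open>The losses over the whole interval add up to
    \<open>(s2 - s1) * \<epsilon> = e\<close>.\<close>
  define \<epsilon> where "\<epsilon> = e / (s2 - s1)"
  have "\<epsilon> > 0" using e s by (simp add: \<epsilon>_def)
  then obtain h0 where h0: "h0 > 0" and step': "\<And>s h. \<lbrakk>s1 \<le> s; 0 < h; h \<le> h0; s + h \<le> s2\<rbrakk> \<Longrightarrow>
      (1 - C * h) * K s + h * w - h * \<epsilon> \<le> K (s + h)"
    using step by meson
  \<comment> \<open>Makes the mesh at most \<open>h0\<close> and \<open>C * h\<close> at most
    1/2.\<close>
  obtain n :: nat where n: "max ((s2 - s1) / h0) (2 * C * (s2 - s1)) < real n"
    using reals_Archimedean2 by blast
  have n0: "0 < real n" using n s C h0 by (smt (verit) divide_pos_pos max.strict_boundedE)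
  define h where "h = (s2 - s1) / n"
  have h: "0 < h" "h \<le> h0" "C * h \<le> 1 / 2" "real n * h = s2 - s1"
    using n n0 s h0 by (auto simp: h_def field_simps)
  have "exp (- 2 * C * (j * h)) * (K s1 + j * h * w) - j * h * \<epsilon> \<le> K (s1 + j * h)" if "j \<le> n" for j :: nat
    using that
  proof (induction j)
    case 0
    then show ?case by simp
  next
    case (Suc j)
    define E where "E = exp (- 2 * C * (j * h))"
    have E: "0 \<le> E" "E \<le> 1" using C h by (auto simp: E_def)
    define d where "d = exp (- 2 * C * h)"
    have d: "0 \<le> d" "d \<le> 1" "d \<le> 1 - C * h"
      using one_minus_ge_exp[of "C * h"] C h by (auto simp: d_def mult.assoc)
    have ES: "exp (- 2 * C * (Suc j * h)) = d * E"
      by (simp add: E_def d_def algebra_simps flip: exp_add)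
    have "real (Suc j) * h \<le> real n * h" using Suc.prems h by (intro mult_right_mono) auto
    then have "s1 + j * h + h \<le> s2" using h by (simp add: algebra_simps)
    then have st: "(1 - C * h) * K (s1 + j * h) + h * w - h * \<epsilon> \<le> K (s1 + j * h + h)"
      using h by (intro step') auto
    have S: "0 \<le> K s1 + j * h * w" using K0 h w by simp
    have "d * (E * (K s1 + j * h * w)) - j * h * \<epsilon>
        \<le> (1 - C * h) * (E * (K s1 + j * h * w)) - (1 - C * h) * (j * h * \<epsilon>)"
      using d S E h C \<open>\<epsilon> > 0\<close> by (intro diff_mono mult_right_mono mult_left_le_one_le) auto
    also have "\<dots> = (1 - C * h) * (E * (K s1 + j * h * w) - j * h * \<epsilon>)" by (simp add: algebra_simps)
    also have "\<dots> \<le> (1 - C * h) * K (s1 + j * h)"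
      using Suc h by (intro mult_left_mono) (auto simp: E_def)
    finally have "d * (E * (K s1 + j * h * w)) - j * h * \<epsilon> \<le> (1 - C * h) * K (s1 + j * h)" .
    \<comment> \<open>The claim discounts the newest source term as well, whereas the step adds it
      in full.\<close>
    moreover have "d * E * (h * w) \<le> h * w"
      using d E h w by (intro mult_left_le_one_le mult_le_one) auto
    ultimately show ?case using st unfolding ES by (simp add: algebra_simps)
  qed
  from this[of n] show "exp (- 2 * C * (s2 - s1)) * (K s1 + (s2 - s1) * w) \<le> K s2 + e"
    using h s by (simp add: \<epsilon>_def)
qed

lemma exp_second_diff_formula:
  "(1 - exp (- l * y))\<^sup>2 = exp (- (2 * l) * y) - 2 * exp (- l * y) + (1::real)"
  by (simp add: power2_eq_square algebra_simps flip: exp_add)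

text \<open>Isolates what the growth estimate uses: a conservative semigroup and its generator on
  exponentials, with convergence uniform in the starting point.\<close>

locale exponential_generator =
  fixes p :: "real \<Rightarrow> real \<Rightarrow> real measure" and a b :: real
    and I :: "nat set" and \<alpha> \<gamma> :: "nat \<Rightarrow> real"
  assumes transition: "transition_function p"
    and b_nonneg: "0 \<le> b" and finite_I: "finite I"
    and \<gamma>_pos: "\<And>i. i \<in> I \<Longrightarrow> 0 < \<gamma> i" and \<alpha>_gt_1: "\<And>i. i \<in> I \<Longrightarrow> 1 < \<alpha> i"
    and generator: "\<And>l. 0 < l \<Longrightarrow> uniform_limit {0..}
      (\<lambda>t x. ((\<integral>y. exp (- l * y) \<partial>p t x) - exp (- l * x)) / t)
      (\<lambda>x. exp (- l * x) * (x * ((\<Sum>i\<in>I. \<gamma> i * l powr \<alpha> i) - a * l) - b * l)) (at_right 0)"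
begin

definition exp_gen :: "real \<Rightarrow> real \<Rightarrow> real" where
  "exp_gen l x = exp (- l * x) * (x * ((\<Sum>i\<in>I. \<gamma> i * l powr \<alpha> i) - a * l) - b * l)"

text \<open>The constant C of the inequality for the generator: \<open>2 * \<gamma> i\<close> from
  each power of \<open>l\<close>, and \<open>2 * \<bar>a\<bar>\<close> from the drift.\<close>

definition decay :: real where "decay = 2 * \<bar>a\<bar> + 2 * (\<Sum>i\<in>I. \<gamma> i)"

lemma decay_nonneg: "0 \<le> decay"
  unfolding decay_def using \<gamma>_pos by (intro add_nonneg_nonneg mult_nonneg_nonneg sum_nonneg) (auto intro: less_imp_le)

section \<open>Integration against the transition kernels\<close>

lemma kernel_measurable: "0 \<le> s \<Longrightarrow> p s \<in> nonneg_borel \<rightarrow>\<^sub>M prob_algebra nonneg_borel"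
  using transition by (simp add: transition_function_def)

lemma kernel_prob:
  assumes "0 \<le> s" "0 \<le> x"
  shows "prob_space (p s x)" "sets (p s x) = sets nonneg_borel" "space (p s x) = {0..}"
proof -
  have "p s x \<in> space (prob_algebra nonneg_borel)"
    using measurable_space[OF kernel_measurable[OF assms(1)]] assms(2) by simp
  then show "prob_space (p s x)" and s: "sets (p s x) = sets nonneg_borel"
    by (auto simp: space_prob_algebra)
  show "space (p s x) = {0..}" using sets_eq_imp_space_eq[OF s] by simp
qed

lemma kernel_integrable:
  fixes f :: "real \<Rightarrow> real"
  assumes "0 \<le> s" "0 \<le> x" "f \<in> borel_measurable nonneg_borel" "\<And>y. 0 \<le> y \<Longrightarrow> \<bar>f y\<bar> \<le> B"
  shows "integrable (p s x) f"
proof -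
  interpret prob_space "p s x" using kernel_prob(1)[OF assms(1,2)] .
  show ?thesis
    by (rule integrable_const_bound[where B=B])
      (use assms kernel_prob[OF assms(1,2)] in \<open>auto intro!: AE_I2 cong: measurable_cong_sets\<close>)
qed

lemma kernel_exp_integrable:
  assumes "0 \<le> s" "0 \<le> x" "0 \<le> l"
  shows "integrable (p s x) (\<lambda>y. exp (- l * y))"
  using assms by (intro kernel_integrable[where B=1]) (auto intro!: measurable_restrict_space1)

lemma kernel_integral_measurable:
  fixes f :: "real \<Rightarrow> real"
  assumes "0 \<le> h" "f \<in> borel_measurable nonneg_borel"
  shows "(\<lambda>y. \<integral>z. f z \<partial>p h y) \<in> borel_measurable nonneg_borel"
  by (rule measurable_compose[OF measurable_prob_algebraD[OF kernel_measurable[OF assms(1)]]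
        integral_measurable_subprob_algebra[OF assms(2)]])

lemma chapman_kolmogorov_integral:
  fixes f :: "real \<Rightarrow> real"
  assumes s: "0 \<le> s" and h: "0 \<le> h" and x: "0 \<le> x"
    and f: "f \<in> borel_measurable nonneg_borel" "\<And>y. 0 \<le> y \<Longrightarrow> \<bar>f y\<bar> \<le> B"
  shows "(\<integral>y. f y \<partial>p (s + h) x) = (\<integral>y. (\<integral>z. f z \<partial>p h y) \<partial>p s x)"
proof -
  have eq: "p (s + h) x = p s x \<bind> p h"
    using transition s h x by (simp add: transition_function_def)
  interpret prob_space "p s x" using kernel_prob(1)[OF s x] .
  have N: "p h \<in> p s x \<rightarrow>\<^sub>M subprob_algebra nonneg_borel"
    using measurable_prob_algebraD[OF kernel_measurable[OF h]] kernel_prob(2)[OF s x]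
    by (simp cong: measurable_cong_sets)
  show ?thesis unfolding eq
    by (rule integral_bind[where K=nonneg_borel and B=B and B'=1])
      (use f N kernel_prob[OF s x] prob_space.emeasure_space_1[OF kernel_prob(1)[OF h]] finite_measure_axioms
        in \<open>auto intro!: AE_I2\<close>)
qed

lemma kernel_integral_bounded:
  fixes f :: "real \<Rightarrow> real"
  assumes "0 \<le> h" "0 \<le> y" "f \<in> borel_measurable nonneg_borel" "\<And>y. 0 \<le> y \<Longrightarrow> \<bar>f y\<bar> \<le> B"
  shows "\<bar>\<integral>z. f z \<partial>p h y\<bar> \<le> B"
proof -
  interpret prob_space "p h y" using kernel_prob(1)[OF assms(1,2)] .
  have int: "integrable (p h y) (\<lambda>z. \<bar>f z\<bar>)"
    using kernel_integrable[OF assms] by (rule Bochner_Integration.integrable_abs)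
  have "\<bar>\<integral>z. f z \<partial>p h y\<bar> \<le> (\<integral>z. \<bar>f z\<bar> \<partial>p h y)" by (rule integral_abs_bound)
  also have "\<dots> \<le> B"
    using kernel_prob[OF assms(1,2)] assms(4) by (intro integral_le_const int AE_I2) auto
  finally show ?thesis .
qed

text \<open>The right-hand side is the generator on \<open>(1 - exp (- l * y))\<^sup>2\<close>,
  constants contributing 0. Each power of \<open>l\<close> is bounded by
  \<open>exp_second_diff_lower\<close>; the drift gives
  \<open>2 * a * (l * y * e) * (1 - e)\<close>, at least \<open>- 2 * \<bar>a\<bar>\<close> times
  the square; the term with \<open>b\<close> is nonnegative.\<close>

lemma generator_second_diff:
  assumes l: "0 < l" "l \<le> 1" and y: "0 \<le> y" and i: "i \<in> I"
  shows "\<gamma> i * (2 powr \<alpha> i - 2) * l powr \<alpha> i * (y * exp (- 2 * y)) - decay * (1 - exp (- l * y))\<^sup>2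
    \<le> exp_gen (2 * l) y - 2 * exp_gen l y"
proof -
  define k where "k = (1 - exp (- l * y))\<^sup>2"
  define e where "e = exp (- l * y)"
  have e: "0 < e" "e \<le> 1" using l y by (auto simp: e_def)
  have e2: "exp (- (2 * l) * y) = e\<^sup>2"
    by (simp add: e_def power2_eq_square algebra_simps flip: exp_add)
  have two: "2 \<le> 2 powr \<alpha> j" if "j \<in> I" for j
    using powr_mono[of 1 "\<alpha> j" 2] \<alpha>_gt_1[OF that] by simp
  \<comment> \<open>All summands are nonnegative since \<open>2 \<le> 2 powr \<alpha> j\<close>, so
    one of them is at most the sum.\<close>
  have "\<gamma> i * (2 powr \<alpha> i - 2) * l powr \<alpha> i * (y * exp (- 2 * y)) - (\<Sum>j\<in>I. \<gamma> j) * (2 * k)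
      \<le> (\<Sum>j\<in>I. \<gamma> j * ((2 powr \<alpha> j - 2) * l powr \<alpha> j * (y * exp (- 2 * y)))) - (\<Sum>j\<in>I. \<gamma> j) * (2 * k)"
    using member_le_sum[OF i, of "\<lambda>j. \<gamma> j * ((2 powr \<alpha> j - 2) * l powr \<alpha> j * (y * exp (- 2 * y)))"]
      finite_I \<gamma>_pos two y by (fastforce simp: mult.assoc less_imp_le intro!: mult_nonneg_nonneg)
  also have "\<dots> = (\<Sum>j\<in>I. \<gamma> j * ((2 powr \<alpha> j - 2) * l powr \<alpha> j * (y * exp (- 2 * y)) - 2 * k))"
    by (simp add: right_diff_distrib sum_subtractf sum_distrib_right)
  also have "\<dots> \<le> (\<Sum>j\<in>I. \<gamma> j * (y * ((2 * l) powr \<alpha> j * e\<^sup>2 - 2 * l powr \<alpha> j * e)))"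
  proof (intro sum_mono mult_left_mono)
    fix j assume "j \<in> I"
    then show "(2 powr \<alpha> j - 2) * l powr \<alpha> j * (y * exp (- 2 * y)) - 2 * k
        \<le> y * ((2 * l) powr \<alpha> j * e\<^sup>2 - 2 * l powr \<alpha> j * e)"
      using exp_second_diff_lower[OF l y \<alpha>_gt_1, of j] unfolding k_def e2 e_def[symmetric] by simp
    show "0 \<le> \<gamma> j" using \<gamma>_pos[OF \<open>j \<in> I\<close>] by simp
  qed
  also have "\<dots> = y * (\<Sum>j\<in>I. \<gamma> j * (2 * l) powr \<alpha> j) * e\<^sup>2 - 2 * (y * (\<Sum>j\<in>I. \<gamma> j * l powr \<alpha> j) * e)"
    by (simp add: sum_distrib_left sum_distrib_right sum_subtractf algebra_simps)
  finally have A: "\<gamma> i * (2 powr \<alpha> i - 2) * l powr \<alpha> i * (y * exp (- 2 * y)) - (\<Sum>j\<in>I. \<gamma> j) * (2 * k) \<le> \<dots>" .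
  have "l * y * e \<le> 1 - e" using x_exp_minus_le[of "l * y"] by (simp add: e_def)
  then have "(l * y * e) * (1 - e) \<le> (1 - e) * (1 - e)" using e by (intro mult_right_mono) auto
  then have "\<bar>a\<bar> * ((l * y * e) * (1 - e)) \<le> \<bar>a\<bar> * k"
    by (intro mult_left_mono) (auto simp: k_def e_def power2_eq_square)
  moreover have "- \<bar>a\<bar> * ((l * y * e) * (1 - e)) \<le> a * ((l * y * e) * (1 - e))"
    using e l y by (intro mult_right_mono) auto
  ultimately have B: "- (\<bar>a\<bar> * k) \<le> a * ((l * y * e) * (1 - e))" by linarith
  have D: "0 \<le> b * (l * (e * (1 - e)))" using b_nonneg e l by simp
  have "exp_gen (2 * l) y - 2 * exp_gen l y = y * (\<Sum>j\<in>I. \<gamma> j * (2 * l) powr \<alpha> j) * e\<^sup>2 - 2 * (y * (\<Sum>j\<in>I. \<gamma> j * l powr \<alpha> j) * e)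
     + 2 * (a * ((l * y * e) * (1 - e))) + 2 * (b * (l * (e * (1 - e))))"
    unfolding exp_gen_def e2 e_def[symmetric] by (simp add: algebra_simps power2_eq_square)
  then show ?thesis using A B D unfolding k_def[symmetric] decay_def by (simp add: algebra_simps)
qed

text \<open>Turns the generator bound into a bound for small times. The error is uniform in
  \<open>y\<close>, so that the inequality can later be integrated against the law at any
  time.\<close>

lemma semigroup_second_diff:
  assumes l: "0 < l" "l \<le> 1" and i: "i \<in> I" and \<epsilon>: "\<epsilon> > 0"
  obtains h0 where "h0 > 0" and "\<And>h y. \<lbrakk>0 < h; h \<le> h0; 0 \<le> y\<rbrakk> \<Longrightarrow>
    (1 - decay * h) * (1 - exp (- l * y))\<^sup>2
      + h * (\<gamma> i * (2 powr \<alpha> i - 2) * l powr \<alpha> i * (exp (- 2 * y) - exp (- 3 * y))) - h * \<epsilon>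
    \<le> (\<integral>z. (1 - exp (- l * z))\<^sup>2 \<partial>p h y)"
proof -
  let ?D = "\<lambda>l h y. ((\<integral>z. exp (- l * z) \<partial>p h y) - exp (- l * y)) / h"
  have ev: "\<forall>\<^sub>F h in at_right 0. \<forall>y\<in>{0..}. dist (?D m h y) (exp_gen m y) < \<epsilon> / 3" if "0 < m" for m
    unfolding exp_gen_def using uniform_limitD[OF generator[OF that], of "\<epsilon> / 3"] \<epsilon> by simp
  \<comment> \<open>The two quotients enter with weights 1 and -2, so errors below
    \<open>\<epsilon> / 3\<close> add up to less than \<epsilon>.\<close>
  have "\<forall>\<^sub>F h in at_right 0. (\<forall>y\<in>{0..}. dist (?D (2 * l) h y) (exp_gen (2 * l) y) < \<epsilon> / 3)
      \<and> (\<forall>y\<in>{0..}. dist (?D l h y) (exp_gen l y) < \<epsilon> / 3)"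
    using l by (intro eventually_conj ev) auto
  then obtain h1 where h1: "0 < h1" and D: "\<And>h y. \<lbrakk>0 < h; h < h1; 0 \<le> y\<rbrakk> \<Longrightarrow>
      dist (?D (2 * l) h y) (exp_gen (2 * l) y) < \<epsilon> / 3 \<and> dist (?D l h y) (exp_gen l y) < \<epsilon> / 3"
    unfolding eventually_at_right_field by auto
  show thesis
  \<comment> \<open>Halving makes room for the non-strict bound on \<open>h\<close>.\<close>
  proof (rule that[of "h1 / 2"])
    fix h y :: real assume h: "0 < h" "h \<le> h1 / 2" and y: "0 \<le> y"
    define k where "k = (1 - exp (- l * y))\<^sup>2"
    define w where "w = \<gamma> i * (2 powr \<alpha> i - 2) * l powr \<alpha> i"
    interpret prob_space "p h y" using kernel_prob(1)[of h y] h y by simp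
    have "(\<integral>z. (1 - exp (- l * z))\<^sup>2 \<partial>p h y) = (\<integral>z. exp (- (2 * l) * z) \<partial>p h y) - 2 * (\<integral>z. exp (- l * z) \<partial>p h y) + 1"
      unfolding exp_second_diff_formula
      using kernel_exp_integrable[of h y "2 * l"] kernel_exp_integrable[of h y l] h y l
      by (simp add: prob_space)
    moreover have hD: "h * ?D m h y = (\<integral>z. exp (- m * z) \<partial>p h y) - exp (- m * y)" for m
      using h by simp
    ultimately have P: "(\<integral>z. (1 - exp (- l * z))\<^sup>2 \<partial>p h y) - k = h * (?D (2 * l) h y - 2 * ?D l h y)"
      unfolding k_def exp_second_diff_formula[of l y] right_diff_distrib mult.left_commute[of h 2]
      using hD[of "2 * l"] hD[of l] by linarith
    have "0 \<le> w"
      using powr_mono[of 1 "\<alpha> i" 2] \<alpha>_gt_1[OF i] \<gamma>_pos[OF i] by (simp add: w_def)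
    \<comment> \<open>Replaces \<open>y * exp (- 2 * y)\<close> by a combination of exponentials,
      whose expectation the generator controls.\<close>
    moreover have "exp (- 2 * y) - exp (- 3 * y) \<le> y * exp (- 2 * y)"
    proof -
      have "exp (- 3 * y) = exp (- 2 * y) * exp (- y)" by (simp flip: exp_add)
      moreover have "exp (- 2 * y) * (1 - y) \<le> exp (- 2 * y) * exp (- y)"
        using exp_ge_add_one_self[of "- y"] by (intro mult_left_mono) auto
      ultimately show ?thesis by (simp add: algebra_simps)
    qed
    ultimately have "w * (exp (- 2 * y) - exp (- 3 * y)) - decay * k \<le> w * (y * exp (- 2 * y)) - decay * k"
      by (simp add: mult_left_mono)
    also have "\<dots> \<le> exp_gen (2 * l) y - 2 * exp_gen l y"
      unfolding w_def k_def by (rule generator_second_diff[OF l y i])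
    also have "\<dots> - \<epsilon> \<le> ?D (2 * l) h y - 2 * ?D l h y"
      using D[of h y] h h1 y unfolding dist_real_def by linarith
    finally have "h * (w * (exp (- 2 * y) - exp (- 3 * y)) - decay * k - \<epsilon>) \<le> (\<integral>z. (1 - exp (- l * z))\<^sup>2 \<partial>p h y) - k"
      unfolding P using h by (intro mult_left_mono) auto
    then show "(1 - decay * h) * (1 - exp (- l * y))\<^sup>2
      + h * (\<gamma> i * (2 powr \<alpha> i - 2) * l powr \<alpha> i * (exp (- 2 * y) - exp (- 3 * y))) - h * \<epsilon>
    \<le> (\<integral>z. (1 - exp (- l * z))\<^sup>2 \<partial>p h y)"
      unfolding k_def[symmetric] w_def[symmetric] by (simp add: algebra_simps)
  qed (use h1 in simp)
qed

text \<open>The integrand is a combination of test functions below $y e^{-2y}$. It is positive at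
  \<open>x > 0\<close>, while at \<open>x = 0\<close> it vanishes and its generator equals \<open>b\<close>.\<close>

lemma occupation_lower_bound:
  assumes x: "0 \<le> x" and pos: "0 < x \<or> 0 < b"
  obtains c s0 where "0 < c" "0 < s0"
    and "\<And>s. \<lbrakk>0 < s; s < s0\<rbrakk> \<Longrightarrow> c * s \<le> (\<integral>y. exp (- 2 * y) - exp (- 3 * y) \<partial>p s x)"
proof -
  define q where "q y = exp (- 2 * y) - exp (- 3 * y)" for y :: real
  let ?D = "\<lambda>l s. ((\<integral>y. exp (- l * y) \<partial>p s x) - exp (- l * x)) / s"
  define d where "d = exp_gen 2 x - exp_gen 3 x"
  have lim: "((\<lambda>s. ?D l s) \<longlongrightarrow> exp_gen l x) (at_right 0)" if "0 < l" for l
    unfolding exp_gen_def using tendsto_uniform_limitI[OF generator[OF that], of x] x by simp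
  have "((\<lambda>s. ?D 2 s - ?D 3 s) \<longlongrightarrow> d) (at_right 0)"
    unfolding d_def by (intro tendsto_diff lim) auto
  have eq: "(\<integral>y. q y \<partial>p s x) = q x + s * (?D 2 s - ?D 3 s)" if "0 < s" for s
    using that x kernel_exp_integrable[of s x 2] kernel_exp_integrable[of s x 3]
    by (simp add: q_def field_simps)
  have ev: "\<forall>\<^sub>F s in at_right 0. r < ?D 2 s - ?D 3 s" if "r < d" for r
    by (rule order_tendstoD(1)[OF \<open>((\<lambda>s. ?D 2 s - ?D 3 s) \<longlongrightarrow> d) (at_right 0)\<close> that])
  have "\<exists>c>0. \<forall>\<^sub>F s in at_right 0. c * s \<le> (\<integral>y. q y \<partial>p s x)"
  proof (cases "x = 0")
    case True
    \<comment> \<open>At 0, \<open>exp_gen l 0 = - b * l\<close>, hence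
      \<open>d = 3 * b - 2 * b\<close>. The slope \<open>b / 2\<close> used below stays strictly
      under this limit.\<close>
    then have d: "d = b" "0 < b" using pos by (simp_all add: d_def exp_gen_def)
    then have d_gt: "b / 2 < d" by simp
    have "\<forall>\<^sub>F s in at_right 0. b / 2 * s \<le> (\<integral>y. q y \<partial>p s x)"
      using ev[of "b / 2", OF d_gt] eventually_at_right_less[of 0]
    proof (eventually_elim)
      case (elim s)
      have "s * (b / 2) \<le> s * (?D 2 s - ?D 3 s)" using elim d by (intro mult_left_mono) auto
      then show ?case using eq[of s] elim True by (simp add: q_def mult.commute)
    qed
    then show ?thesis using d by (intro exI[of _ "b / 2"]) auto
  next
    case False
    have d_gt: "d - 1 < d" by simp
    \<comment> \<open>The integral tends to \<open>q x > 0\<close> as \<open>s\<close> tends to 0,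
      so it eventually exceeds \<open>s\<close> itself.\<close>
    have q: "0 < q x" using False x by (simp add: q_def)
    have "((\<lambda>s. q x + s * (d - 1) - s * 1) \<longlongrightarrow> q x + 0 * (d - 1) - 0 * 1) (at_right 0)"
      by (intro tendsto_intros)
    then have "\<forall>\<^sub>F s in at_right 0. 0 < q x + s * (d - 1) - s * 1"
      by (rule order_tendstoD(1)) (use q in simp)
    then have "\<forall>\<^sub>F s in at_right 0. 1 * s \<le> (\<integral>y. q y \<partial>p s x)"
      using ev[of "d - 1", OF d_gt] eventually_at_right_less[of 0]
    proof (eventually_elim)
      case (elim s)
      have "s * (d - 1) \<le> s * (?D 2 s - ?D 3 s)" using elim by (intro mult_left_mono) auto
      then show ?case using eq[of s] elim by linarith
    qed
    then show ?thesis by (intro exI[of _ 1]) auto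
  qed
  then show thesis unfolding eventually_at_right_field q_def using that by auto
qed

text \<open>On an early interval \<open>[s1, s2]\<close> the occupation bound supplies a source of
  size at least a constant times \<open>l powr \<alpha> i\<close>; from \<open>s2\<close> to
  \<open>t\<close> what has accumulated can only decay at a fixed rate. Neither the times nor the
  rate depend on \<open>l\<close>.\<close>

lemma second_diff_lower_bound:
  assumes x: "0 \<le> x" and pos: "0 < x \<or> 0 < b" and t: "0 < t" and i: "i \<in> I"
  obtains c where "0 < c"
    and "\<And>l. \<lbrakk>0 < l; l \<le> 1\<rbrakk> \<Longrightarrow> c * l powr \<alpha> i \<le> (\<integral>y. (1 - exp (- l * y))\<^sup>2 \<partial>p t x)"
proof -
  define q where "q y = exp (- 2 * y) - exp (- 3 * y)" for y :: real
  define \<kappa> where "\<kappa> = \<gamma> i * (2 powr \<alpha> i - 2)"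
  have \<kappa>: "0 < \<kappa>"
    using powr_less_mono[of 1 "\<alpha> i" 2] \<alpha>_gt_1[OF i] \<gamma>_pos[OF i] by (simp add: \<kappa>_def)
  obtain c s0 where c: "0 < c" and s0: "0 < s0"
    and occ: "\<And>s. \<lbrakk>0 < s; s < s0\<rbrakk> \<Longrightarrow> c * s \<le> (\<integral>y. q y \<partial>p s x)"
    unfolding q_def using occupation_lower_bound[OF x pos] by blast
  \<comment> \<open>Below \<open>s0\<close>, where the occupation bound holds, and below
    \<open>t\<close>.\<close>
  define s2 where "s2 = min s0 t / 2"
  define s1 where "s1 = s2 / 2"
  have s: "0 < s1" "s1 < s2" "s2 < s0" "s2 < t" using s0 t by (auto simp: s1_def s2_def)
  \<comment> \<open>Decay after \<open>s2\<close>, decay on \<open>[s1, s2]\<close>, and the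
    accumulated source, with \<open>l powr \<alpha> i\<close> taken out.\<close>
  define c' where "c' = exp (- 2 * decay * (t - s2)) * (exp (- 2 * decay * (s2 - s1)) * ((s2 - s1) * (\<kappa> * (c * s1))))"
  have "0 < c'" using s c \<kappa> by (simp add: c'_def)
  moreover have "c' * l powr \<alpha> i \<le> (\<integral>y. (1 - exp (- l * y))\<^sup>2 \<partial>p t x)" if l: "0 < l" "l \<le> 1" for l
  proof -
    let ?k = "\<lambda>y. (1 - exp (- l * y))\<^sup>2"
    define K where "K s = (\<integral>y. ?k y \<partial>p s x)" for s
    define L where "L = \<kappa> * l powr \<alpha> i"
    have L: "0 < L" using \<kappa> l by (simp add: L_def)
    have K0: "0 \<le> K s" for s unfolding K_def by (intro integral_nonneg_AE AE_I2) simp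
    have k_meas: "?k \<in> borel_measurable nonneg_borel" by (intro measurable_restrict_space1) simp
    have k_bd: "\<bar>?k y\<bar> \<le> 1" if "0 \<le> y" for y
      using that l by (auto simp: power_le_one)
    have q_int: "integrable (p s x) q" if "0 \<le> s" for s
      using kernel_exp_integrable[OF that x, of 2] kernel_exp_integrable[OF that x, of 3]
      unfolding q_def by auto
    have q_nonneg: "0 \<le> (\<integral>y. q y \<partial>p s x)" if "0 \<le> s" for s
      using kernel_prob(3)[OF that x] by (intro integral_nonneg_AE AE_I2) (auto simp: q_def)
    \<comment> \<open>The small-time inequality, started from the law at time \<open>s\<close> and
      integrated; Chapman-Kolmogorov identifies the result as \<open>K (s + h)\<close>.\<close>
    have step: "\<exists>h0>0. \<forall>s h. 0 \<le> s \<longrightarrow> 0 < h \<longrightarrow> h \<le> h0 \<longrightarrow>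
        (1 - decay * h) * K s + h * (L * (\<integral>y. q y \<partial>p s x)) - h * \<epsilon> \<le> K (s + h)" if \<epsilon>: "\<epsilon> > 0" for \<epsilon>
    proof -
      obtain h0 where h0: "h0 > 0" and lower: "\<And>h y. \<lbrakk>0 < h; h \<le> h0; 0 \<le> y\<rbrakk> \<Longrightarrow>
          (1 - decay * h) * ?k y + h * (L * q y) - h * \<epsilon> \<le> (\<integral>z. ?k z \<partial>p h y)"
        using semigroup_second_diff[OF l i \<epsilon>] unfolding L_def \<kappa>_def q_def by metis
      show ?thesis
      proof (intro exI[of _ h0] conjI h0 allI impI)
        fix s h :: real assume sh: "0 \<le> s" "0 < h" "h \<le> h0"
        interpret prob_space "p s x" using kernel_prob(1)[OF sh(1) x] .
        have k_int: "integrable (p s x) ?k" by (rule kernel_integrable[OF sh(1) x k_meas k_bd])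
        have "(1 - decay * h) * K s + h * (L * (\<integral>y. q y \<partial>p s x)) - h * \<epsilon>
            = (\<integral>y. (1 - decay * h) * ?k y + h * (L * q y) - h * \<epsilon> \<partial>p s x)"
          using k_int q_int[OF sh(1)] by (simp add: K_def prob_space del: mult_minus_left)
        also have "\<dots> \<le> (\<integral>y. (\<integral>z. ?k z \<partial>p h y) \<partial>p s x)"
        proof (rule integral_mono)
          show "integrable (p s x) (\<lambda>y. (1 - decay * h) * ?k y + h * (L * q y) - h * \<epsilon>)"
            using k_int q_int[OF sh(1)] by (intro Bochner_Integration.integrable_diff
                Bochner_Integration.integrable_add integrable_mult_right) auto
          show "integrable (p s x) (\<lambda>y. \<integral>z. ?k z \<partial>p h y)"
            using sh x k_meas k_bd
            by (intro kernel_integrable[where B=1] kernel_integral_measurable kernel_integral_bounded) auto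
          show "(1 - decay * h) * ?k y + h * (L * q y) - h * \<epsilon> \<le> (\<integral>z. ?k z \<partial>p h y)"
            if "y \<in> space (p s x)" for y
            using lower[of h y] sh that kernel_prob(3)[OF sh(1) x] by simp
        qed
        also have "\<dots> = K (s + h)"
          unfolding K_def using sh x k_meas k_bd
          by (intro chapman_kolmogorov_integral[symmetric]) auto
        finally show "(1 - decay * h) * K s + h * (L * (\<integral>y. q y \<partial>p s x)) - h * \<epsilon> \<le> K (s + h)" .
      qed
    qed
    have early: "exp (- 2 * decay * (s2 - s1)) * (K s1 + (s2 - s1) * (L * (c * s1))) \<le> K s2"
    proof (rule euler_lower_bound[OF s(2) decay_nonneg _ K0])
      show "0 \<le> L * (c * s1)" using L c s by simp
      fix \<epsilon> :: real assume "\<epsilon> > 0"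
      then obtain h0 where h0: "h0 > 0" and st: "\<And>s h. \<lbrakk>0 \<le> s; 0 < h; h \<le> h0\<rbrakk> \<Longrightarrow>
        (1 - decay * h) * K s + h * (L * (\<integral>y. q y \<partial>p s x)) - h * \<epsilon> \<le> K (s + h)"
        using step by meson
      show "\<exists>h0>0. \<forall>s h. s1 \<le> s \<longrightarrow> 0 < h \<longrightarrow> h \<le> h0 \<longrightarrow> s + h \<le> s2 \<longrightarrow>
          (1 - decay * h) * K s + h * (L * (c * s1)) - h * \<epsilon> \<le> K (s + h)"
      proof (intro exI[of _ h0] conjI h0 allI impI)
        fix s' h assume sh: "s1 \<le> s'" "0 < h" "h \<le> h0" "s' + h \<le> s2"
        have "c * s1 \<le> c * s'" using c sh by simp
        also have "\<dots> \<le> (\<integral>y. q y \<partial>p s' x)" using sh s by (intro occ) auto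
        finally have "h * (L * (c * s1)) \<le> h * (L * (\<integral>y. q y \<partial>p s' x))"
          using sh L by (intro mult_left_mono) auto
        then show "(1 - decay * h) * K s' + h * (L * (c * s1)) - h * \<epsilon> \<le> K (s' + h)"
          using st[of s' h] sh s by linarith
      qed
    qed
    \<comment> \<open>Past \<open>s2\<close> the source is only known to be nonnegative, so it is
      bounded by 0.\<close>
    have late: "exp (- 2 * decay * (t - s2)) * (K s2 + (t - s2) * 0) \<le> K t"
    proof (rule euler_lower_bound[OF s(4) decay_nonneg _ K0])
      fix \<epsilon> :: real assume "\<epsilon> > 0"
      then obtain h0 where h0: "h0 > 0" and st: "\<And>s h. \<lbrakk>0 \<le> s; 0 < h; h \<le> h0\<rbrakk> \<Longrightarrow>
        (1 - decay * h) * K s + h * (L * (\<integral>y. q y \<partial>p s x)) - h * \<epsilon> \<le> K (s + h)"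
        using step by meson
      show "\<exists>h0>0. \<forall>s h. s2 \<le> s \<longrightarrow> 0 < h \<longrightarrow> h \<le> h0 \<longrightarrow> s + h \<le> t \<longrightarrow>
          (1 - decay * h) * K s + h * 0 - h * \<epsilon> \<le> K (s + h)"
      proof (intro exI[of _ h0] conjI h0 allI impI)
        fix s' h assume sh: "s2 \<le> s'" "0 < h" "h \<le> h0" "s' + h \<le> t"
        have "0 \<le> h * (L * (\<integral>y. q y \<partial>p s' x))"
          using sh L s q_nonneg[of s'] by (intro mult_nonneg_nonneg) auto
        then show "(1 - decay * h) * K s' + h * 0 - h * \<epsilon> \<le> K (s' + h)"
          using st[of s' h] sh s by linarith
      qed
    qed simp
    have "c' * l powr \<alpha> i
        = exp (- 2 * decay * (t - s2)) * (exp (- 2 * decay * (s2 - s1)) * (0 + (s2 - s1) * (L * (c * s1))))"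
      by (simp add: c'_def L_def mult_ac)
    also have "\<dots> \<le> exp (- 2 * decay * (t - s2)) * (exp (- 2 * decay * (s2 - s1)) * (K s1 + (s2 - s1) * (L * (c * s1))))"
      by (intro mult_left_mono add_right_mono K0) auto
    also have "\<dots> \<le> exp (- 2 * decay * (t - s2)) * K s2" by (intro mult_left_mono early) simp
    also have "\<dots> \<le> K t" using late by simp
    finally show ?thesis unfolding K_def .
  qed
  ultimately show thesis by (rule that)
qed

end

section \<open>Moments of the short rate\<close>

text \<open>The Markov property at time 0 makes the conditional probability of \<open>B\<close>
  almost surely the constant \<open>measure (p t r0) B\<close>; taking expectations gives the law of
  \<open>R t\<close>.\<close>

lemma distr_markov_process:
  assumes mp: "nonneg_markov_process M R p" and r0: "0 \<le> r0" and init: "AE w in M. R 0 w = r0"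
    and t: "0 \<le> t"
  shows "distr M nonneg_borel (R t) = p t r0"
proof -
  interpret prob_space M using mp by (simp add: nonneg_markov_process_def)
  have meas: "R u \<in> measurable M nonneg_borel" if "0 \<le> u" for u
    using mp that by (simp add: nonneg_markov_process_def)
  let ?F = "past M R 0"
  define \<F> where "\<F> = {R 0 -` B \<inter> space M |B. B \<in> sets nonneg_borel}"
  have \<F>: "\<F> \<subseteq> sets M"
    using measurable_sets[OF meas[of 0]] by (auto simp: \<F>_def)
  then have "\<F> \<subseteq> Pow (space M)" by (auto dest: sets.sets_into_space)
  \<comment> \<open>As \<open>{0..0}\<close> is a singleton, the past at time 0 is generated by
    \<open>R 0\<close> alone.\<close>
  moreover have "?F = sigma (space M) \<F>" by (simp add: past_def \<F>_def)
  ultimately have "subalgebra M ?F"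
    using sets.sigma_sets_subset[OF \<F>] by (simp add: subalgebra_def)
  then interpret F: finite_measure_subalgebra M ?F by unfold_locales
  have p: "prob_space (p t r0)" "sets (p t r0) = sets nonneg_borel"
  proof -
    have "p t \<in> measurable nonneg_borel (prob_algebra nonneg_borel)"
      using mp t by (simp add: nonneg_markov_process_def transition_function_def)
    then have "p t r0 \<in> space (prob_algebra nonneg_borel)"
      using r0 by (auto dest: measurable_space)
    then show "prob_space (p t r0)" "sets (p t r0) = sets nonneg_borel"
      by (auto simp: space_prob_algebra)
  qed
  interpret p: prob_space "p t r0" by (rule p)
  show ?thesis
  proof (rule measure_eqI)
    show "sets (distr M nonneg_borel (R t)) = sets (p t r0)" using p by simp
    fix B assume "B \<in> sets (distr M nonneg_borel (R t))"
    then have B: "B \<in> sets nonneg_borel" by simp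
    have int: "integrable M (\<lambda>w. indicator B (R (0 + t) w) :: real)"
      using meas[OF t] B by (intro integrable_const_bound[where B=1]) (auto intro!: AE_I2 simp: indicator_def)
    have "AE w in M. real_cond_exp M ?F (\<lambda>w. indicator B (R (0 + t) w)) w = measure (p t (R 0 w)) B"
      using mp t B by (auto simp: nonneg_markov_process_def)
    then have "AE w in M. real_cond_exp M ?F (\<lambda>w. indicator B (R (0 + t) w)) w = measure (p t r0) B"
      using init by eventually_elim simp
    then have "(\<integral>w. real_cond_exp M ?F (\<lambda>w. indicator B (R (0 + t) w)) w \<partial>M) = (\<integral>w. measure (p t r0) B \<partial>M)"
      by (intro integral_cong_AE) auto
    then have "(\<integral>w. indicator B (R (0 + t) w) \<partial>M) = measure (p t r0) B"
      using F.real_cond_exp_int(2)[OF int] by (simp add: prob_space)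
    moreover have "B \<inter> {0..} = B" using sets.sets_into_space[OF B] by auto
    then have "(\<integral>w. indicator B (R (0 + t) w) \<partial>M) = measure (distr M nonneg_borel (R t)) B"
      using integral_distr[OF meas[OF t], of "indicator B :: real \<Rightarrow> real"] B
      by (simp add: prob_space.finite_measure[OF prob_space_distr[OF meas[OF t]]])
    ultimately show "emeasure (distr M nonneg_borel (R t)) B = emeasure (p t r0) B"
      using prob_space.finite_measure[OF prob_space_distr[OF meas[OF t]]]
      by (simp add: finite_measure.emeasure_eq_measure p.emeasure_eq_measure)
  qed
qed

text \<open>\<open>1 - exp (- l * y)\<close> lies between 0 and both 1 and \<open>l * y\<close>. On
  the unit interval a square is at most a power of order \<open>r \<le> 2\<close>; the summand 1
  covers \<open>y \<le> 1\<close>, where \<open>y powr s\<close> may fall below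
  \<open>y powr r\<close>.\<close>

lemma second_diff_le_powr:
  assumes l: "0 \<le> l" and y: "0 \<le> y" and r: "0 \<le> r" "r \<le> 2" "r \<le> s"
  shows "(1 - exp (- l * y))\<^sup>2 \<le> l powr r * (1 + y powr (s :: real))"
proof -
  define z where "z = 1 - exp (- l * y)"
  have z: "0 \<le> z" "z \<le> 1" "z \<le> l * y"
    using l y exp_ge_add_one_self[of "- l * y"] by (auto simp: z_def)
  have "z\<^sup>2 \<le> z powr r"
  proof (cases "z = 0")
    case False
    then have "z powr 2 \<le> z powr r" using z r by (intro powr_mono') auto
    then show ?thesis using z False by (simp add: powr_numeral)
  qed simp
  also have "\<dots> \<le> (l * y) powr r" using z r by (intro powr_mono2) auto
  also have "\<dots> = l powr r * y powr r" using l y by (simp add: powr_mult)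
  also have "y powr r \<le> 1 + y powr s"
  proof (cases "y \<le> 1")
    case True
    then have "y powr r \<le> 1" using y r by (intro powr_le1) auto
    then show ?thesis by (simp add: add_increasing2)
  next
    case False
    then have "y powr r \<le> y powr s" using r(3) by (intro powr_mono) auto
    then show ?thesis by linarith
  qed
  finally show ?thesis unfolding z_def by (simp add: mult_left_mono)
qed

theorem proposition3p8:
  fixes M :: "'w measure" and R :: "real \<Rightarrow> 'w \<Rightarrow> real"
    and g :: nat and a b r0 :: real and \<alpha> \<eta> :: "nat \<Rightarrow> real"
    and t \<epsilon> :: real
  assumes "g \<ge> 1" and "b \<ge> 0" and "r0 \<ge> 0"
    and "\<alpha> 1 \<le> 2" and "strict_antimono_on {1..g} \<alpha>" and "\<alpha> g \<in> {1<..<2}"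
    and "\<forall>i\<in>{1..g}. \<eta> i > 0"
    and "R \<in> short_rate_class M g a b \<alpha> \<eta>"
    and "AE w in M. R 0 w = r0"
    and "r0 > 0 \<or> b > 0"
    and "t > 0" and "\<epsilon> > 0"
  shows "(\<integral>\<^sup>+w. ennreal (R t w powr (\<alpha> g + \<epsilon>)) \<partial>M) = \<infinity>"
proof (rule ccontr)
  assume fin: "(\<integral>\<^sup>+w. ennreal (R t w powr (\<alpha> g + \<epsilon>)) \<partial>M) \<noteq> \<infinity>"
  obtain p where mp: "nonneg_markov_process M R p"
    and gen: "has_generator p (short_rate_generator g a b \<alpha> \<eta>)"
    using assms(8) by (auto simp: short_rate_class_def)
  obtain \<gamma> where \<gamma>: "\<And>i. i \<in> {1..g} \<Longrightarrow> \<gamma> i > 0"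
    and form: "\<And>l x. \<lbrakk>0 < l; 0 \<le> x\<rbrakk> \<Longrightarrow> short_rate_generator g a b \<alpha> \<eta> (\<lambda>x. exp (- l * x)) x
          = exp (- l * x) * (x * ((\<Sum>i=1..g. \<gamma> i * l powr \<alpha> i) - a * l) - b * l)"
    using short_rate_generator_exp[OF assms(1) assms(4-7)] by blast
  interpret exponential_generator p a b "{1..g}" \<alpha> \<gamma>
  proof
    show "transition_function p" using mp by (simp add: nonneg_markov_process_def)
    show "1 < \<alpha> i" if "i \<in> {1..g}" for i
      using monotone_onD[OF assms(5) that, of g] that assms(6) by (cases "i = g") auto
    fix l :: real assume l: "0 < l"
    then have "(\<lambda>x. exp (- l * x)) \<in> test_functions" unfolding test_functions_def by blast
    then have "uniform_limit {0..} (\<lambda>t x. ((\<integral>y. exp (- l * y) \<partial>p t x) - exp (- l * x)) / t)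
        (short_rate_generator g a b \<alpha> \<eta> (\<lambda>x. exp (- l * x))) (at_right 0)"
      using gen unfolding has_generator_def by blast
    \<comment> \<open>The closed form is available for \<open>x \<ge> 0\<close>, exactly the set on
      which the limit is taken.\<close>
    then show "uniform_limit {0..} (\<lambda>t x. ((\<integral>y. exp (- l * y) \<partial>p t x) - exp (- l * x)) / t)
      (\<lambda>x. exp (- l * x) * (x * ((\<Sum>i=1..g. \<gamma> i * l powr \<alpha> i) - a * l) - b * l)) (at_right 0)"
      by (rule uniform_limit_cong'[THEN iffD1, rotated 2]) (use form[OF l] in auto)
  qed (use assms \<gamma> in auto)
  interpret M: prob_space M using mp by (simp add: nonneg_markov_process_def)
  have R: "R t \<in> measurable M nonneg_borel"
    using mp assms(11) by (simp add: nonneg_markov_process_def)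
  then have R_borel [measurable]: "R t \<in> borel_measurable M" by (simp add: measurable_restrict_space2_iff)
  have R_nonneg: "0 \<le> R t w" if "w \<in> space M" for w using measurable_space[OF R that] by simp
  obtain c where c: "0 < c"
    and lower: "\<And>l. \<lbrakk>0 < l; l \<le> 1\<rbrakk> \<Longrightarrow> c * l powr \<alpha> g \<le> (\<integral>y. (1 - exp (- l * y))\<^sup>2 \<partial>p t r0)"
    using second_diff_lower_bound[OF assms(3,10,11), of g] assms(1) by auto
  define m where "m = (\<integral>w. R t w powr (\<alpha> g + \<epsilon>) \<partial>M)"
  have int: "integrable M (\<lambda>w. R t w powr (\<alpha> g + \<epsilon>))"
    using fin by (intro integrableI_bounded) (auto simp: less_top)
  \<comment> \<open>The cap 2 is the order to which the second difference vanishes at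
    \<open>l = 0\<close>; \<open>\<alpha> g < 2\<close> keeps \<open>r\<close> above
    \<open>\<alpha> g\<close>.\<close>
  define r where "r = min (\<alpha> g + \<epsilon>) 2"
  have r: "\<alpha> g < r" "0 \<le> r" "r \<le> 2" "r \<le> \<alpha> g + \<epsilon>" using assms(6,12) by (auto simp: r_def)
  have upper: "(\<integral>y. (1 - exp (- l * y))\<^sup>2 \<partial>p t r0) \<le> l powr r * (1 + m)" if l: "0 < l" for l
  proof -
    have "(\<integral>y. (1 - exp (- l * y))\<^sup>2 \<partial>p t r0) = (\<integral>w. (1 - exp (- l * R t w))\<^sup>2 \<partial>M)"
      unfolding distr_markov_process[OF mp assms(3,9) less_imp_le[OF assms(11)], symmetric]
      by (rule integral_distr[OF R]) (intro measurable_restrict_space1, simp)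
    also have "\<dots> \<le> (\<integral>w. l powr r * (1 + R t w powr (\<alpha> g + \<epsilon>)) \<partial>M)"
    proof (rule integral_mono)
      show "integrable M (\<lambda>w. (1 - exp (- l * R t w))\<^sup>2)"
        using R_nonneg l by (intro M.integrable_const_bound[where B=1]) (auto intro!: AE_I2 simp: power_le_one)
      show "integrable M (\<lambda>w. l powr r * (1 + R t w powr (\<alpha> g + \<epsilon>)))" using int by simp
    qed (use second_diff_le_powr[OF _ R_nonneg r(2-4)] l in auto)
    also have "\<dots> = l powr r * (1 + m)" using int by (simp add: m_def M.prob_space)
    finally show ?thesis .
  qed
  \<comment> \<open>Divided by \<open>l powr \<alpha> g\<close>, the upper bound tends to 0 while
    the lower bound stays at \<open>c\<close>.\<close>
  have "((\<lambda>l::real. l powr (r - \<alpha> g) * (1 + m)) \<longlongrightarrow> 0 * (1 + m)) (at_right 0)"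
    by (intro tendsto_mult tendsto_const tendsto_zero_powrI[where b="r - \<alpha> g"] tendsto_ident_at)
      (use r in \<open>auto simp: eventually_at_filter\<close>)
  then have "\<forall>\<^sub>F l in at_right 0. l powr (r - \<alpha> g) * (1 + m) < c"
    by (rule order_tendstoD(2)) (use c in simp)
  moreover have "\<forall>\<^sub>F l::real in at_right 0. 0 < l \<and> l \<le> 1"
    unfolding eventually_at_right_field by (intro exI[of _ 1]) auto
  \<comment> \<open>Absurd, because the filter at the right of 0 is nontrivial.\<close>
  ultimately have "\<forall>\<^sub>F l::real in at_right 0. False"
  proof eventually_elim
    case (elim l)
    have "c * l powr \<alpha> g \<le> l powr r * (1 + m)" using lower upper elim by (meson order_trans)
    also have "\<dots> = l powr (r - \<alpha> g) * (1 + m) * l powr \<alpha> g" using elim by (simp add: powr_diff)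
    also have "\<dots> < c * l powr \<alpha> g" using elim by (intro mult_strict_right_mono) auto
    finally show False by simp
  qed
  then show False by simp
qed

end
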